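(* Let $k\in[0,1)$ and let $S$ be a weakly regular AG-groupoid with left identity. Then the following conditions are equivalent: (i) $S$ is intra-regular. (ii) $f\wedge_k g\le f\circ_k g$ for every $(\in,\in\vee q_k)$-fuzzy left ideal $f$ and every $(\in,\in\vee q_k)$-fuzzy right ideal $g$ of $S$.
   Context: An AG-groupoid is a (non-empty) set $S$ with a binary operation satisfying $(ab)c=(cb)a$ for all $a,b,c\in S$. A left identity is an element $e$ with $ea=a$ for all $a$. $S$ is weakly regular if for each $a\in S$ there are $x,y\in S$ with $a=(ax)(ay)$; $S$ is intra-regular if for each $a\in S$ there are $x,y\in S$ with $a=(xa^2)y$, where $a^2=aa$. A fuzzy subset of $S$ is a map $f:S\to[0,1]$; $\wedge$ denotes minimum, and $f\le g$ is meant pointwise. The product is $(f\circ g)(a)=\sup_{a=bc}\, (f(b)\wedge g(c))$ (supremum over all $b,c\in S$ with $a=bc$), and $(f\circ g)(a)=0$ if $a$ is not a product of two elements. Further, $(f\wedge_k g)(a)=f(a)\wedge g(a)\wedge\frac{1-k}{2}$ and $(f\circ_k g)(a)=(f\circ g)(a)\wedge\frac{1-k}{2}$. For $x\in S$, $t\in(0,1]$: $x_t\in f$ means $f(x)\ge t$; $x_t q_k f$ means $f(x)+t+k>1$; $x_t\in\vee q_k f$ means $x_t\in f$ or $x_tq_kf$. A fuzzy subset $f$ is an $(\in,\in\vee q_k)$-fuzzy left (right) ideal if $y_t\in f$ implies $(xy)_t\in\vee q_k f$ (respectively $(yx)_t\in\vee q_kf$) for all $x,y\in S$, $t\in(0,1]$;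 equivalently $f(xy)\ge f(y)\wedge\frac{1-k}{2}$ (respectively $f(xy)\ge f(x)\wedge\frac{1-k}{2}$) for all $x,y$. *)

theory Defs
  imports Complex_Main
begin

locale ag_groupoid =
  fixes S :: "'a set" and mult :: "'a \<Rightarrow> 'a \<Rightarrow> 'a" (infixl "\<cdot>" 70)
  assumes nonempty: "S \<noteq> {}"
    and closed: "\<lbrakk>a \<in> S; b \<in> S\<rbrakk> \<Longrightarrow> a \<cdot> b \<in> S"
    and left_invertive: "\<lbrakk>a \<in> S; b \<in> S; c \<in> S\<rbrakk> \<Longrightarrow> (a \<cdot> b) \<cdot> c = (c \<cdot> b) \<cdot> a"

definition left_identity :: "'a set \<Rightarrow> ('a \<Rightarrow> 'a \<Rightarrow> 'a) \<Rightarrow> 'a \<Rightarrow> bool" where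
  "left_identity S m e \<longleftrightarrow> e \<in> S \<and> (\<forall>a\<in>S. m e a = a)"

definition weakly_regular :: "'a set \<Rightarrow> ('a \<Rightarrow> 'a \<Rightarrow> 'a) \<Rightarrow> bool" where
  "weakly_regular S m \<longleftrightarrow> (\<forall>a\<in>S. \<exists>x\<in>S. \<exists>y\<in>S. a = m (m a x) (m a y))"

definition intra_regular :: "'a set \<Rightarrow> ('a \<Rightarrow> 'a \<Rightarrow> 'a) \<Rightarrow> bool" where
  "intra_regular S m \<longleftrightarrow> (\<forall>a\<in>S. \<exists>x\<in>S. \<exists>y\<in>S. a = m (m x (m a a)) y)"

text \<open>A fuzzy subset of \<open>S\<close> is a total function of which only the values on \<open>S\<close> matter.\<close>

definition fuzzy_subset :: "'a set \<Rightarrow> ('a \<Rightarrow> real) \<Rightarrow> bool" where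
  "fuzzy_subset S f \<longleftrightarrow> (\<forall>a\<in>S. 0 \<le> f a \<and> f a \<le> 1)"

definition fuzzy_le :: "'a set \<Rightarrow> ('a \<Rightarrow> real) \<Rightarrow> ('a \<Rightarrow> real) \<Rightarrow> bool" where
  "fuzzy_le S f g \<longleftrightarrow> (\<forall>a\<in>S. f a \<le> g a)"

text \<open>The case distinction is needed because \<open>Sup {}\<close> is unspecified on the reals.\<close>

definition fuzzy_prod ::
    "'a set \<Rightarrow> ('a \<Rightarrow> 'a \<Rightarrow> 'a) \<Rightarrow> ('a \<Rightarrow> real) \<Rightarrow> ('a \<Rightarrow> real) \<Rightarrow> 'a \<Rightarrow> real" where
  "fuzzy_prod S m f g a =
     (if \<exists>b\<in>S. \<exists>c\<in>S. a = m b c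
      then Sup {min (f b) (g c) | b c. b \<in> S \<and> c \<in> S \<and> a = m b c}
      else 0)"

definition fuzzy_inf_k :: "real \<Rightarrow> ('a \<Rightarrow> real) \<Rightarrow> ('a \<Rightarrow> real) \<Rightarrow> 'a \<Rightarrow> real" where
  "fuzzy_inf_k k f g a = min (min (f a) (g a)) ((1 - k) / 2)"

definition fuzzy_prod_k ::
    "'a set \<Rightarrow> ('a \<Rightarrow> 'a \<Rightarrow> 'a) \<Rightarrow> real \<Rightarrow> ('a \<Rightarrow> real) \<Rightarrow> ('a \<Rightarrow> real) \<Rightarrow> 'a \<Rightarrow> real" where
  "fuzzy_prod_k S m k f g a = min (fuzzy_prod S m f g a) ((1 - k) / 2)"

text \<open>The fuzzy point with support \<open>x\<close> and value \<open>t\<close> enters only through its relations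
  to a fuzzy subset, so it is passed as the two arguments \<open>x\<close> and \<open>t\<close>.\<close>

definition point_in :: "'a \<Rightarrow> real \<Rightarrow> ('a \<Rightarrow> real) \<Rightarrow> bool" where
  "point_in x t f \<longleftrightarrow> f x \<ge> t"

definition point_q :: "real \<Rightarrow> 'a \<Rightarrow> real \<Rightarrow> ('a \<Rightarrow> real) \<Rightarrow> bool" where
  "point_q k x t f \<longleftrightarrow> f x + t + k > 1"

definition point_in_or_q :: "real \<Rightarrow> 'a \<Rightarrow> real \<Rightarrow> ('a \<Rightarrow> real) \<Rightarrow> bool" where
  "point_in_or_q k x t f \<longleftrightarrow> point_in x t f \<or> point_q k x t f"

definition fuzzy_left_ideal ::
    "'a set \<Rightarrow> ('a \<Rightarrow> 'a \<Rightarrow> 'a) \<Rightarrow> real \<Rightarrow> ('a \<Rightarrow> real) \<Rightarrow> bool" where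
  "fuzzy_left_ideal S m k f \<longleftrightarrow> fuzzy_subset S f \<and>
     (\<forall>x\<in>S. \<forall>y\<in>S. \<forall>t\<in>{0<..1}. point_in y t f \<longrightarrow> point_in_or_q k (m x y) t f)"

definition fuzzy_right_ideal ::
    "'a set \<Rightarrow> ('a \<Rightarrow> 'a \<Rightarrow> 'a) \<Rightarrow> real \<Rightarrow> ('a \<Rightarrow> real) \<Rightarrow> bool" where
  "fuzzy_right_ideal S m k f \<longleftrightarrow> fuzzy_subset S f \<and>
     (\<forall>x\<in>S. \<forall>y\<in>S. \<forall>t\<in>{0<..1}. point_in y t f \<longrightarrow> point_in_or_q k (m y x) t f)"

end

(* Since (ax)(ay) = (aa)(xy), weak regularity gives a = (aa)z = (e(aa))z = (za)a. The middle form
   shows that S is intra-regular, and the last one shows that (ii) holds, because f(za) is at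
   least f(a) min (1-k)/2. So under the standing hypotheses both conditions are always true. *)

theory Submission
  imports Defs
begin

text \<open>Left invertivity, used three times, gathers the two copies of \<open>a\<close>: the
  first use pulls one copy out to the right end, the second brings the other next to it, giving
  ((xy)a)a, and the third folds both into a square. The witness is z = xy.\<close>

lemma (in ag_groupoid) weakly_regular_square_factor:
  assumes "weakly_regular S mult" and a: "a \<in> S"
  obtains z where "z \<in> S" and "a = (a \<cdot> a) \<cdot> z"
proof -
  obtain x y where x: "x \<in> S" and y: "y \<in> S" and a_eq: "a = (a \<cdot> x) \<cdot> (a \<cdot> y)"
    using assms unfolding weakly_regular_def by blast
  have "(a \<cdot> x) \<cdot> (a \<cdot> y) = ((a \<cdot> y) \<cdot> x) \<cdot> a"
    using a x y by (simp add: left_invertive closed)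
  also have "\<dots> = ((x \<cdot> y) \<cdot> a) \<cdot> a"
    using left_invertive[OF a y x] by simp
  also have "\<dots> = (a \<cdot> a) \<cdot> (x \<cdot> y)"
    using left_invertive[OF closed[OF x y] a a] .
  finally show thesis
    using that[of "x \<cdot> y"] a_eq closed[OF x y] by simp
qed

lemma (in ag_groupoid) weakly_regular_imp_intra_regular:
  assumes "left_identity S mult e" and "weakly_regular S mult"
  shows "intra_regular S mult"
  unfolding intra_regular_def
proof
  fix a assume a: "a \<in> S"
  then obtain z where z: "z \<in> S" and a_eq: "a = (a \<cdot> a) \<cdot> z"
    using weakly_regular_square_factor assms(2) by blast
  have e: "e \<in> S" and "e \<cdot> (a \<cdot> a) = a \<cdot> a"
    using assms(1) closed[OF a a] by (auto simp: left_identity_def)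
  then have "a = (e \<cdot> (a \<cdot> a)) \<cdot> z"
    using a_eq by simp
  with e z show "\<exists>x\<in>S. \<exists>y\<in>S. a = (x \<cdot> (a \<cdot> a)) \<cdot> y"
    by blast
qed

text \<open>This turns the fuzzy-point condition into an inequality by testing it at the largest
  useful height t = min (f y) ((1 - k) / 2).\<close>

lemma fuzzy_left_ideal_ge:
  assumes f: "fuzzy_left_ideal S m k f" and "x \<in> S" "y \<in> S" "m x y \<in> S"
  shows "min (f y) ((1 - k) / 2) \<le> f (m x y)"
\<comment> \<open>Fuzzy points have height in (0,1], so a nonpositive t cannot be tested; there the
  nonnegativity of \<open>f\<close> on \<open>S\<close> suffices.\<close>
proof (cases "min (f y) ((1 - k) / 2) \<le> 0")
  case True
  moreover have "0 \<le> f (m x y)"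
    using assms by (simp add: fuzzy_left_ideal_def fuzzy_subset_def)
  ultimately show ?thesis
    by linarith
next
  case False
  let ?t = "min (f y) ((1 - k) / 2)"
  have "f y \<le> 1"
    using assms by (simp add: fuzzy_left_ideal_def fuzzy_subset_def)
  then have "?t \<in> {0<..1}"
    using False by (simp add: not_le min_le_iff_disj)
  moreover have "point_in y ?t f"
    by (simp add: point_in_def)
  ultimately have "point_in_or_q k (m x y) ?t f"
    using assms unfolding fuzzy_left_ideal_def by blast
  \<comment> \<open>In the \<open>point_q\<close> case, f(xy) > 1 - k - t \<ge> (1 - k)/2 \<ge> t,
    because t \<le> (1 - k)/2.\<close>
  then show ?thesis
    unfolding point_in_or_q_def point_in_def point_q_def by (auto simp: min_def field_simps split: if_splits)
qed

lemma fuzzy_prod_ge: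
  assumes "fuzzy_subset S f" and "b \<in> S" "c \<in> S"
  shows "min (f b) (g c) \<le> fuzzy_prod S m f g (m b c)"
proof -
  let ?A = "{min (f b') (g c') | b' c'. b' \<in> S \<and> c' \<in> S \<and> m b c = m b' c'}"
  \<comment> \<open>A real \<open>Sup\<close> dominates its elements only if the set is bounded;
    each minimum is at most f b' \<le> 1.\<close>
  have "bdd_above ?A"
    using assms(1) by (intro bdd_aboveI[where M = 1]) (auto simp: fuzzy_subset_def min_le_iff_disj)
  moreover have "min (f b) (g c) \<in> ?A"
    using assms by blast
  ultimately have "min (f b) (g c) \<le> Sup ?A"
    by (rule cSup_upper[rotated])
  then show ?thesis
    using assms unfolding fuzzy_prod_def by auto
qed

lemma (in ag_groupoid) weakly_regular_imp_fuzzy_inf_le_prod: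
  assumes "weakly_regular S mult" and f: "fuzzy_left_ideal S mult k f"
  shows "fuzzy_le S (fuzzy_inf_k k f g) (fuzzy_prod_k S mult k f g)"
  unfolding fuzzy_le_def
proof
  fix a assume a: "a \<in> S"
  then obtain z where z: "z \<in> S" and "a = (a \<cdot> a) \<cdot> z"
    using weakly_regular_square_factor assms(1) by blast
  \<comment> \<open>In this factorization the right factor is \<open>a\<close> itself, so
    \<open>g a\<close> enters unchanged. Replacing f(za) by f(a) costs only the cap (1 - k)/2, which
    \<open>fuzzy_inf_k\<close> already contains.\<close>
  then have a_eq: "a = (z \<cdot> a) \<cdot> a"
    using left_invertive[OF a a z] by simp
  have "min (f (z \<cdot> a)) (g a) \<le> fuzzy_prod S mult f g a"
    using fuzzy_prod_ge[of S f "z \<cdot> a" a g mult] f closed[OF z a] a a_eq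
    by (simp add: fuzzy_left_ideal_def)
  moreover have "min (f a) ((1 - k) / 2) \<le> f (z \<cdot> a)"
    using fuzzy_left_ideal_ge[OF f z a closed[OF z a]] .
  ultimately show "fuzzy_inf_k k f g a \<le> fuzzy_prod_k S mult k f g a"
    unfolding fuzzy_inf_k_def fuzzy_prod_k_def by linarith
qed

theorem theorem20:
  fixes S :: "'a set" and mult :: "'a \<Rightarrow> 'a \<Rightarrow> 'a" and k :: real
  assumes "0 \<le> k" and "k < 1"
    and "ag_groupoid S mult"
    and "\<exists>e. left_identity S mult e"
    and "weakly_regular S mult"
  shows "intra_regular S mult \<longleftrightarrow>
    (\<forall>f g. fuzzy_left_ideal S mult k f \<and> fuzzy_right_ideal S mult k g \<longrightarrow>
       fuzzy_le S (fuzzy_inf_k k f g) (fuzzy_prod_k S mult k f g))"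
proof -
  interpret ag_groupoid S mult by fact
  show ?thesis
    using weakly_regular_imp_intra_regular weakly_regular_imp_fuzzy_inf_le_prod assms by blast
qed

end
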